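(* Let $n_v\ge 1$, $N\ge 1$, and let $i_l,j_l$ ($l=1,\dots,n_v$) be integers modulo $N$ with $i_1=j_1=0$. Let $$H_3=\begin{bmatrix}1&\cdots&1\\ x^{i_1}&\cdots&x^{i_{n_v}}\\ x^{j_1}&\cdots&x^{j_{n_v}}\end{bmatrix},$$ a $3N\times n_vN$ matrix. Below $u,v$ range over $[n_v]=\{1,\dots,n_v\}$. Then $\mathrm{girth}(H_3)>10$ if and only if, for all $l\in[n_v]$, the following three conditions hold: 1) each two of the four sets $\{i_u-i_v\mid u\ne v,\ u\neq l\}$, $\{j_u-j_v\mid u\ne v,\ u\ne l\}$, $\{-j_u+j_v-i_v+i_l\mid u\ne v,\ v\ne l\}$, $\{-i_u+i_v-j_v+j_l\mid u\ne v,\ v\ne l\}$ contain non-equal values, and each set is of maximal size; 2) each two of the four sets $\{i_u-j_u+j_v\mid u\ne v,\ v\ne l\}$, $\{i_u-i_v+i_l\mid u\ne v,\ v\neq l\}$, $\{(i_u-j_u)-(i_v-j_v)+i_l\mid u\ne v,\ v\ne l\}$, $\{i_u-j_v+j_l\mid u\ne v,\ v\ne l\}$ contain non-equal values, and each set is of maximal size; 3) each two of the four sets $\{j_u-i_u+i_v\mid u\ne v,\ v\ne l\}$, $\{j_u-i_v+i_l\mid u\ne v,\ v\ne l\}$, $\{j_u-j_v+j_l\mid u\ne v,\ v\ne l\}$, $\{j_u-i_u+i_v-j_v+j_l\mid u\ne v,\ v\ne l\}$ contain non-equal values, and each set is of maximal size.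
   Context: $x^r$ denotes the $N\times N$ circulant permutation matrix obtained from the identity by cyclically shifting to the left by $r$ positions; exponents are taken modulo $N$, and $1=x^0$ is the $N\times N$ identity. An indexed set is "of maximal size" if its listed values, for different index pairs $(u,v)$, are pairwise distinct modulo $N$. Two sets "contain non-equal values" if they are disjoint in $\mathbb Z/N\mathbb Z$. The Tanner graph of a $0/1$ matrix is the bipartite graph with one check node per row, one variable node per column, and an edge for each entry equal to $1$; $\mathrm{girth}(M)$ is the length of a shortest cycle in the Tanner graph of $M$ ($+\infty$ if there is none). *)

theory Defs
  imports
    "HOL-Library.Extended_Nat"
    "HOL-Number_Theory.Cong"
    "Jordan_Normal_Form.Matrix"
begin

text \<open>Column \<open>b\<close> of \<open>x^r\<close> is column \<open>b + r\<close> (mod \<open>N\<close>) of the identity, i.e. the columns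
  of the identity are shifted cyclically to the left by \<open>r\<close> positions.\<close>

definition circ :: "nat \<Rightarrow> int \<Rightarrow> nat mat" where
  "circ N r = mat N N (\<lambda>(a, b). 1\<^sub>m N $$ (a, nat ((int b + r) mod int N)))"

definition block_mat :: "nat \<Rightarrow> nat \<Rightarrow> nat \<Rightarrow> (nat \<Rightarrow> nat \<Rightarrow> 'a mat) \<Rightarrow> 'a mat" where
  "block_mat m n N B =
     mat (m * N) (n * N) (\<lambda>(r, c). B (r div N) (c div N) $$ (r mod N, c mod N))"

text \<open>Matrix blocks are numbered from \<open>0\<close>, whereas \<open>i\<close> and \<open>j\<close> are indexed by \<open>{1..n}\<close>.\<close>

definition H3 :: "nat \<Rightarrow> nat \<Rightarrow> (nat \<Rightarrow> int) \<Rightarrow> (nat \<Rightarrow> int) \<Rightarrow> nat mat" where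
  "H3 N n i j =
     block_mat 3 n N (\<lambda>b l. [1\<^sub>m N, circ N (i (l + 1)), circ N (j (l + 1))] ! b)"

type_synonym 'v ugraph = "'v set \<times> 'v set set"

definition is_cycle :: "'v ugraph \<Rightarrow> 'v list \<Rightarrow> bool" where
  "is_cycle G p \<longleftrightarrow>
     3 \<le> length p \<and> distinct p \<and> set p \<subseteq> fst G \<and>
     (\<forall>k < length p. {p ! k, p ! (Suc k mod length p)} \<in> snd G)"

text \<open>In \<^typ>\<open>enat\<close> the infimum of the empty set is \<open>\<infinity>\<close>.\<close>

definition girth :: "'v ugraph \<Rightarrow> enat" where
  "girth G = (INF p \<in> {p. is_cycle G p}. enat (length p))"

datatype tanner_vertex = Check nat | Var nat

definition tanner_graph :: "nat mat \<Rightarrow> tanner_vertex ugraph" where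
  "tanner_graph M =
     (Check ` {..<dim_row M} \<union> Var ` {..<dim_col M},
      {{Check r, Var c} | r c. r < dim_row M \<and> c < dim_col M \<and> M $$ (r, c) = 1})"

text \<open>An indexed set of integers modulo \<open>N\<close> is given by its index set together with its
  value function; the indices are pairs \<open>(u, v)\<close>.\<close>

type_synonym indexed_set = "(nat \<times> nat) set \<times> (nat \<times> nat \<Rightarrow> int)"

definition residues_of :: "nat \<Rightarrow> indexed_set \<Rightarrow> int set" where
  "residues_of N F = (\<lambda>p. snd F p mod int N) ` fst F"

definition maximal_size :: "nat \<Rightarrow> indexed_set \<Rightarrow> bool" where
  "maximal_size N F \<longleftrightarrow> inj_on (\<lambda>p. snd F p mod int N) (fst F)"

definition non_equal_values :: "nat \<Rightarrow> indexed_set \<Rightarrow> indexed_set \<Rightarrow> bool" where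
  "non_equal_values N F G \<longleftrightarrow> residues_of N F \<inter> residues_of N G = {}"

definition all_non_equal_maximal :: "nat \<Rightarrow> indexed_set list \<Rightarrow> bool" where
  "all_non_equal_maximal N Fs \<longleftrightarrow>
     (\<forall>a < length Fs. \<forall>b < length Fs. a \<noteq> b \<longrightarrow> non_equal_values N (Fs ! a) (Fs ! b)) \<and>
     (\<forall>F \<in> set Fs. maximal_size N F)"

definition pairs_fst_ne :: "nat \<Rightarrow> nat \<Rightarrow> (nat \<times> nat) set" where
  "pairs_fst_ne n l = {(u, v). u \<in> {1..n} \<and> v \<in> {1..n} \<and> u \<noteq> v \<and> u \<noteq> l}"

definition pairs_snd_ne :: "nat \<Rightarrow> nat \<Rightarrow> (nat \<times> nat) set" where
  "pairs_snd_ne n l = {(u, v). u \<in> {1..n} \<and> v \<in> {1..n} \<and> u \<noteq> v \<and> v \<noteq> l}"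

end

theory Submission
  imports Defs
begin

text \<open>Unfold the Tanner graph from a check in row block \<open>0\<close>. The four indexed sets of each condition
  are the positions, within one fixed row block, of the ends of the reduced walks from that check which
  cross three columns if they start with column block \<open>l\<close> and two columns otherwise. If two of
  them coincide, the walks (without their common first edge, if there is one) close up to a
  non-backtracking walk of length at most \<open>10\<close>, which contains a cycle. Conversely, a closed
  non-backtracking walk of length \<open>10\<close> meets row block \<open>0\<close> because an odd cyclic word cannot
  alternate between two row blocks, and there it splits into a three-column and a two-column walk;
  walks of length \<open>6\<close> and \<open>8\<close> are first extended by a common piece, and a \<open>4\<close>-cycle is traversed
  twice. The only \<open>8\<close>-walks where no free column block exists for the extension alternate between two
  column blocks; they are treated by listing the possible values.\<close>

section \<open>Non-backtracking walks and girth\<close>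

fun nb_walk :: "'v ugraph \<Rightarrow> 'v list \<Rightarrow> bool" where
  "nb_walk G (a # b # c # w) \<longleftrightarrow> {a, b} \<in> snd G \<and> a \<noteq> c \<and> nb_walk G (b # c # w)"
| "nb_walk G [a, b] \<longleftrightarrow> {a, b} \<in> snd G"
| "nb_walk G [a] \<longleftrightarrow> True"
| "nb_walk G [] \<longleftrightarrow> True"

lemma nb_walk_edge:
  "nb_walk G w \<Longrightarrow> Suc t < length w \<Longrightarrow> {w ! t, w ! Suc t} \<in> snd G"
proof (induction G w arbitrary: t rule: nb_walk.induct)
  case (1 G a b c w)
  then show ?case by (cases t) auto
qed (auto simp: less_Suc_eq)

lemma nb_walk_no_backtrack:
  "nb_walk G w \<Longrightarrow> Suc (Suc t) < length w \<Longrightarrow> w ! t \<noteq> w ! Suc (Suc t)"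
proof (induction G w arbitrary: t rule: nb_walk.induct)
  case (1 G a b c w)
  then show ?case by (cases t) auto
qed auto

text \<open>Used to glue a walk ending in \<open>m\<close> to the reversal of another one with the
  same end; the only new condition is that the two neighbours of \<open>m\<close> differ.\<close>

lemma nb_walk_join:
  "nb_walk G (xs @ [a, m, b] @ ys) \<longleftrightarrow>
     nb_walk G (xs @ [a, m]) \<and> a \<noteq> b \<and> nb_walk G (m # b # ys)"
proof (induction xs)
  case (Cons x xs)
  then show ?case by (cases xs; cases "tl xs") auto
qed auto

lemma nb_walk_butlast: "nb_walk G (xs @ [a, m]) \<Longrightarrow> nb_walk G (xs @ [a])"
proof (induction xs)
  case (Cons x xs)
  then show ?case by (cases xs; cases "tl xs") auto
qed auto

lemma nb_walk_rev: "nb_walk G (rev w) \<longleftrightarrow> nb_walk G w"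
proof (induction G w rule: nb_walk.induct)
  case (1 G a b c w)
  have "nb_walk G (rev (a # b # c # w)) \<longleftrightarrow> nb_walk G (rev w @ [c, b, a] @ [])" by simp
  also have "\<dots> \<longleftrightarrow> nb_walk G (rev (b # c # w)) \<and> c \<noteq> a \<and> nb_walk G [b, a]"
    unfolding nb_walk_join by simp
  finally show ?case using 1 by (auto simp: insert_commute)
qed (auto simp: insert_commute)

definition simple_edges :: "'v ugraph \<Rightarrow> bool" where
  "simple_edges G \<longleftrightarrow> (\<forall>u v. {u, v} \<in> snd G \<longrightarrow> u \<noteq> v \<and> u \<in> fst G \<and> v \<in> fst G)"

lemma girth_greater_iff:
  "girth G > enat k \<longleftrightarrow> (\<forall>p. is_cycle G p \<longrightarrow> length p > k)"
proof -
  have "girth G > enat k \<longleftrightarrow> girth G \<ge> enat (Suc k)"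
    by (simp add: Suc_ile_eq)
  also have "\<dots> \<longleftrightarrow> (\<forall>p. is_cycle G p \<longrightarrow> length p > k)"
    unfolding girth_def le_INF_iff by auto
  finally show ?thesis .
qed

text \<open>A closest pair of equal vertices on the walk bounds a cycle.\<close>

lemma nb_walk_distinct:
  assumes G: "simple_edges G" and girth: "girth G > enat k"
    and w: "nb_walk G w" and len: "length w \<le> Suc k"
  shows "distinct w"
proof (rule ccontr)
  assume "\<not> distinct w"
  then have "\<exists>d s. 0 < d \<and> s + d < length w \<and> w ! s = w ! (s + d)"
    unfolding distinct_conv_nth
    by (metis add_diff_inverse_nat less_imp_le_nat linorder_neqE_nat not_less zero_less_diff)
  then obtain d where d: "\<exists>s. 0 < d \<and> s + d < length w \<and> w ! s = w ! (s + d)"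
    and least: "\<And>d'. d' < d \<Longrightarrow> \<not> (\<exists>s. 0 < d' \<and> s + d' < length w \<and> w ! s = w ! (s + d'))"
    using exists_least_iff[of "\<lambda>d. \<exists>s. 0 < d \<and> s + d < length w \<and> w ! s = w ! (s + d)"]
    by blast
  then obtain s where s: "0 < d" "s + d < length w" "w ! s = w ! (s + d)" by blast
  define p where "p = take d (drop s w)"
  have lp: "length p = d" using s by (simp add: p_def)
  have nth: "p ! t = w ! (s + t)" if "t < d" for t
    using that s by (simp add: p_def)
  have edge: "{w ! (s + t), w ! Suc (s + t)} \<in> snd G" if "t < d" for t
    using nb_walk_edge[OF w, of "s + t"] that s by simp
  \<comment> \<open>A repetition at distance 1 would be a loop and one at distance 2 a backtrack, so
    the stretch is long enough for \<open>is_cycle\<close>.\<close>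
  have "d \<noteq> 1"
  proof
    assume "d = 1"
    then have "{w ! s, w ! s} \<in> snd G" using edge[of 0] s by simp
    then show False using G unfolding simple_edges_def by blast
  qed
  moreover have "d \<noteq> 2"
    using nb_walk_no_backtrack[OF w, of s] s by (auto simp: numeral_2_eq_2)
  ultimately have "3 \<le> d" using s by linarith
  moreover have "distinct p"
    unfolding distinct_conv_nth lp
  proof (intro allI impI)
    fix a b assume ab: "a < d" "b < d" "a \<noteq> b"
    have *: "p ! a \<noteq> p ! b" if "a < b" "b < d" for a b
    proof
      assume "p ! a = p ! b"
      then have "\<exists>s. 0 < b - a \<and> s + (b - a) < length w \<and> w ! s = w ! (s + (b - a))"
        using that s by (intro exI[of _ "s + a"]) (simp add: nth)
      moreover have "b - a < d" using that by linarith
      ultimately show False using least by blast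
    qed
    then show "p ! a \<noteq> p ! b" using ab by (metis linorder_neqE_nat)
  qed
  moreover have "set p \<subseteq> fst G"
  proof
    fix v assume "v \<in> set p"
    then obtain t where "t < d" "v = w ! (s + t)" by (auto simp: in_set_conv_nth lp nth)
    then show "v \<in> fst G" using edge G unfolding simple_edges_def by blast
  qed
  moreover have "{p ! t, p ! (Suc t mod length p)} \<in> snd G" if "t < d" for t
  proof (cases "Suc t < d")
    case True
    then show ?thesis using edge[of t] by (simp add: nth lp)
  next
    case False
    then have "Suc t = d" using that by simp
    then show ?thesis using edge[of t] s nth[of 0] nth[of t] by (auto simp: lp)
  qed
  ultimately have "is_cycle G p" by (auto simp: is_cycle_def lp)
  then have "k < length p" using girth girth_greater_iff by blast
  then show False using len s lp by linarith
qed

text \<open>Common final vertices are stripped off. As soon as the last steps differ,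
  \<open>p\<close> followed by the reversal of \<open>q\<close> is a closed non-backtracking walk.
  It lists \<open>length p + length q - 1\<close> vertices, because the common end is listed once,
  and this is at most \<open>Suc k\<close>, the bound in \<open>nb_walk_distinct\<close>.\<close>

lemma nb_walk_unique:
  assumes G: "simple_edges G" and girth: "girth G > enat k"
  shows "nb_walk G p \<Longrightarrow> nb_walk G q \<Longrightarrow> p \<noteq> [] \<Longrightarrow> q \<noteq> [] \<Longrightarrow> hd p = hd q \<Longrightarrow> last p = last q \<Longrightarrow>
    length p + length q \<le> k + 2 \<Longrightarrow> p = q"
proof (induction "length p" arbitrary: p q)
  case (Suc N p q)
  have closed: "length w = 1" if "nb_walk G w" "w \<noteq> []" "hd w = last w" "length w \<le> Suc k" for w
    using nb_walk_distinct[OF G girth that(1,4)] that(2,3) last_in_set[of "tl w"]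
    by (cases w) (auto split: if_splits)
  show ?case
  proof (cases "length p = 1 \<or> length q = 1")
    case True
    then have "length p = 1" "length q = 1"
      using closed[of p] closed[of q] Suc.prems by (auto simp: length_Suc_conv)
    then show ?thesis using Suc.prems by (auto simp: length_Suc_conv)
  next
    case False
    then obtain p' c m where p: "p = p' @ [c, m]"
      using Suc.prems by (cases p rule: rev_cases; cases "butlast p" rule: rev_cases) auto
    obtain q' d where q: "q = q' @ [d, m]"
      using False Suc.prems p by (cases q rule: rev_cases; cases "butlast q" rule: rev_cases) auto
    show ?thesis
    proof (cases "c = d")
      case True
      have "p' @ [c] = q' @ [d]"
        using Suc.prems Suc.hyps(2) nb_walk_butlast[of G p' c m] nb_walk_butlast[of G q' d m] True
        by (intro Suc.hyps(1)) (auto simp: p q hd_append split: if_splits)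
      then show ?thesis by (simp add: p q)
    next
      case False
      have "nb_walk G (rev q)" using Suc.prems nb_walk_rev by blast
      then have "nb_walk G (p' @ [c, m, d] @ rev q')"
        using Suc.prems False unfolding nb_walk_join by (simp add: p q)
      moreover have "hd (p' @ [c, m, d] @ rev q') = last (p' @ [c, m, d] @ rev q')"
        using Suc.prems by (cases p'; cases q') (auto simp: p q)
      moreover have "length (p' @ [c, m, d] @ rev q') \<le> Suc k"
        using Suc.prems by (simp add: p q)
      ultimately have "length (p' @ [c, m, d] @ rev q') = 1" by (intro closed) auto
      then show ?thesis by simp
    qed
  qed
qed auto

section \<open>The three conditions as injectivity on sets of base paths\<close>

lemma all_non_equal_maximal_iff:
  "all_non_equal_maximal N Fs \<longleftrightarrow>
     inj_on (\<lambda>(a, p). snd (Fs ! a) p mod int N) (SIGMA a:{..<length Fs}. fst (Fs ! a))"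
    (is "_ \<longleftrightarrow> ?inj")
proof
  assume L: "all_non_equal_maximal N Fs"
  then have ne: "\<And>a b. a < length Fs \<Longrightarrow> b < length Fs \<Longrightarrow> a \<noteq> b \<Longrightarrow>
      residues_of N (Fs ! a) \<inter> residues_of N (Fs ! b) = {}"
    and ms: "\<And>a. a < length Fs \<Longrightarrow> inj_on (\<lambda>p. snd (Fs ! a) p mod int N) (fst (Fs ! a))"
    unfolding all_non_equal_maximal_def maximal_size_def non_equal_values_def by auto
  show ?inj
  proof (rule inj_onI)
    fix x y
    assume x: "x \<in> (SIGMA a:{..<length Fs}. fst (Fs ! a))"
      and y: "y \<in> (SIGMA a:{..<length Fs}. fst (Fs ! a))"
      and eq: "(\<lambda>(a, p). snd (Fs ! a) p mod int N) x = (\<lambda>(a, p). snd (Fs ! a) p mod int N) y"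
    obtain a p b q where xy: "x = (a, p)" "y = (b, q)" by (meson surj_pair)
    have "snd (Fs ! a) p mod int N \<in> residues_of N (Fs ! a)"
      "snd (Fs ! b) q mod int N \<in> residues_of N (Fs ! b)"
      using x y by (auto simp: residues_of_def xy intro: imageI)
    then have ab: "a = b" using ne[of a b] x y eq by (auto simp: xy)
    then show "x = y"
      using inj_onD[OF ms[of a], of p q] x y eq by (simp add: xy)
  qed
next
  assume R: ?inj
  show "all_non_equal_maximal N Fs"
    unfolding all_non_equal_maximal_def
  proof (intro conjI allI impI ballI)
    fix a b assume ab: "a < length Fs" "b < length Fs" "a \<noteq> b"
    show "non_equal_values N (Fs ! a) (Fs ! b)"
      unfolding non_equal_values_def residues_of_def
    proof (rule ccontr)
      assume "(\<lambda>p. snd (Fs ! a) p mod int N) ` fst (Fs ! a) \<inter>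
        (\<lambda>p. snd (Fs ! b) p mod int N) ` fst (Fs ! b) \<noteq> {}"
      then obtain p q where "p \<in> fst (Fs ! a)" "q \<in> fst (Fs ! b)"
        "snd (Fs ! a) p mod int N = snd (Fs ! b) q mod int N" by auto
      then show False using inj_onD[OF R, of "(a, p)" "(b, q)"] ab by auto
    qed
  next
    fix F assume "F \<in> set Fs"
    then obtain a where a: "a < length Fs" "F = Fs ! a" by (auto simp: in_set_conv_nth)
    show "maximal_size N F"
      unfolding maximal_size_def
    proof (rule inj_onI)
      fix p q assume "p \<in> fst F" "q \<in> fst F" "snd F p mod int N = snd F q mod int N"
      then show "p = q" using inj_onD[OF R, of "(a, p)" "(a, q)"] a by auto
    qed
  qed
qed

text \<open>A condition on several indexed sets is one injectivity statement on their disjoint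
  union. Here it is transported along a reindexing \<open>h\<close>; below, \<open>S\<close> is a
  set of paths.\<close>

lemma all_non_equal_maximal_iff_inj_on:
  assumes "h ` (SIGMA a:{..<length Fs}. fst (Fs ! a)) = S"
    and "inj_on h (SIGMA a:{..<length Fs}. fst (Fs ! a))"
    and "\<And>a p. a < length Fs \<Longrightarrow> p \<in> fst (Fs ! a) \<Longrightarrow> f (h (a, p)) = snd (Fs ! a) p"
  shows "all_non_equal_maximal N Fs \<longleftrightarrow> inj_on (\<lambda>x. f x mod int N) S"
proof -
  have "inj_on (\<lambda>x. f x mod int N) S \<longleftrightarrow>
      inj_on ((\<lambda>x. f x mod int N) \<circ> h) (SIGMA a:{..<length Fs}. fst (Fs ! a))"
    using comp_inj_on_iff[OF assms(2), of "\<lambda>x. f x mod int N"] assms(1) by auto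
  also have "\<dots> \<longleftrightarrow> all_non_equal_maximal N Fs"
    unfolding all_non_equal_maximal_iff by (rule inj_on_cong) (auto simp: assms(3))
  finally show ?thesis by simp
qed

text \<open>The exponent matrix of \<open>H3\<close>, with row blocks counted from 0 and column
  blocks from 1.\<close>

definition shift :: "(nat \<Rightarrow> int) \<Rightarrow> (nat \<Rightarrow> int) \<Rightarrow> nat \<Rightarrow> nat \<Rightarrow> int" where
  "shift i j b l = [0, i l, j l] ! b"

lemma shift_simps [simp]:
  "shift i j 0 l = 0" "shift i j 1 l = i l" "shift i j (Suc 0) l = i l" "shift i j 2 l = j l"
  by (simp_all add: shift_def numeral_2_eq_2)

text \<open>A path in the base graph starting at row block \<open>b\<close> is a list of steps \<open>(l, c)\<close>, each going
  through column block \<open>l\<close> to row block \<open>c\<close>; its value is the displacement of its lifts.\<close>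

fun path_val :: "(nat \<Rightarrow> nat \<Rightarrow> int) \<Rightarrow> nat \<Rightarrow> (nat \<times> nat) list \<Rightarrow> int" where
  "path_val e b [] = 0"
| "path_val e b ((l, c) # ps) = e c l - e b l + path_val e c ps"

text \<open>The conditions 1, 2, 3 of the theorem are about \<open>z = 0, 1, 2\<close>, see \<open>leaves_0\<close>,
  \<open>leaves_1\<close> and \<open>leaves_2\<close>.\<close>

definition leaves :: "nat \<Rightarrow> nat \<Rightarrow> nat \<Rightarrow> (nat \<times> nat) list set" where
  "leaves n l z =
     {[(a, x), (c, z)] | a x c. {a, c} \<subseteq> {1..n} \<and> a \<noteq> l \<and> c \<noteq> a \<and> x < 3 \<and> x \<noteq> 0 \<and> x \<noteq> z} \<union>
     {[(l, x), (v, y), (u, z)] | x v y u. {l, v, u} \<subseteq> {1..n} \<and> v \<noteq> l \<and> u \<noteq> v \<and>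
        x < 3 \<and> y < 3 \<and> x \<noteq> 0 \<and> y \<noteq> x \<and> y \<noteq> z}"

definition leaves_separated :: "nat \<Rightarrow> nat \<Rightarrow> (nat \<Rightarrow> nat \<Rightarrow> int) \<Rightarrow> nat \<Rightarrow> nat \<Rightarrow> bool" where
  "leaves_separated N n e l z \<longleftrightarrow> inj_on (\<lambda>ps. path_val e 0 ps mod int N) (leaves n l z)"

lemma leaves_two_iff [simp]:
  "[(a, x), (c, z')] \<in> leaves n l z \<longleftrightarrow>
     z' = z \<and> {a, c} \<subseteq> {1..n} \<and> a \<noteq> l \<and> c \<noteq> a \<and> x < 3 \<and> x \<noteq> 0 \<and> x \<noteq> z"
  unfolding leaves_def by auto

lemma leaves_three_iff [simp]:
  "[(l', x), (v, y), (u, z')] \<in> leaves n l z \<longleftrightarrow>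
     l' = l \<and> z' = z \<and> {l, v, u} \<subseteq> {1..n} \<and> v \<noteq> l \<and> u \<noteq> v \<and>
        x < 3 \<and> y < 3 \<and> x \<noteq> 0 \<and> y \<noteq> x \<and> y \<noteq> z"
  unfolding leaves_def by auto

text \<open>Splits a path by length so that \<open>leaves_two_iff\<close> and
  \<open>leaves_three_iff\<close> apply; \<open>leaves_length\<close> refutes the remaining
  lengths.\<close>

lemma path_cases:
  obtains (two) a x c y where "ps = [(a, x), (c, y)]"
  | (three) a x c y d z where "ps = [(a, x), (c, y), (d, z)]"
  | (other) "length ps \<noteq> 2" "length ps \<noteq> 3"
proof -
  consider "length ps = 2" | "length ps = 3" | "length ps \<noteq> 2" "length ps \<noteq> 3" by blast
  then show ?thesis
    by cases (use that in \<open>auto simp: numeral_2_eq_2 numeral_3_eq_3 length_Suc_conv\<close>)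
qed

lemma leaves_length: "ps \<in> leaves n l z \<Longrightarrow> length ps = 2 \<or> length ps = 3"
  unfolding leaves_def by auto

lemma less_3_iff: "(x::nat) < 3 \<longleftrightarrow> x = 0 \<or> x = 1 \<or> x = 2" by auto

lemma Sigma_nth_4:
  "(SIGMA a:{..<length [F0, F1, F2, F3]}. fst ([F0, F1, F2, F3] ! a)) =
     {0} \<times> fst F0 \<union> {1} \<times> fst F1 \<union> {2} \<times> fst F2 \<union> {3} \<times> fst F3"
  by (auto simp: less_Suc_eq numeral_2_eq_2 numeral_3_eq_3)

text \<open>A leaf that returns to row block 0 has intermediate row blocks 1 or 2: two choices for a
  two-step path and, as consecutive ones differ, two for a three-step path. The four indexed sets
  run through these shapes. In the first two, \<open>u\<close> is the first column block; in the
  last two it is the final one, so the index that must differ from \<open>l\<close> changes from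
  \<open>u\<close> to \<open>v\<close>.\<close>

lemma leaves_0:
  assumes "l \<in> {1..n}"
  shows "all_non_equal_maximal N
        [(pairs_fst_ne n l, \<lambda>(u, v). i u - i v),
         (pairs_fst_ne n l, \<lambda>(u, v). j u - j v),
         (pairs_snd_ne n l, \<lambda>(u, v). - j u + j v - i v + i l),
         (pairs_snd_ne n l, \<lambda>(u, v). - i u + i v - j v + j l)] \<longleftrightarrow>
    leaves_separated N n (shift i j) l 0"
    (is "all_non_equal_maximal N ?Fs \<longleftrightarrow> _")
  unfolding leaves_separated_def
proof (rule all_non_equal_maximal_iff_inj_on)
  let ?h = "(\<lambda>(a, (u, v)). [[(u, 1), (v, 0)], [(u, 2), (v, 0)],
          [(l, 1), (v, 2), (u, 0)], [(l, 2), (v, 1), (u, 0)]] ! a)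
      :: nat \<times> nat \<times> nat \<Rightarrow> (nat \<times> nat) list"
  show "?h ` (SIGMA a:{..<length ?Fs}. fst (?Fs ! a)) = leaves n l 0"
  proof (rule Set.set_eqI)
    fix ps
    show "ps \<in> ?h ` (SIGMA a:{..<length ?Fs}. fst (?Fs ! a)) \<longleftrightarrow> ps \<in> leaves n l 0"
      using assms unfolding Sigma_nth_4
      by (cases ps rule: path_cases)
        (auto simp: image_Un image_iff pairs_fst_ne_def pairs_snd_ne_def less_3_iff
          dest: leaves_length)
  qed
  show "inj_on ?h (SIGMA a:{..<length ?Fs}. fst (?Fs ! a))"
    unfolding Sigma_nth_4 inj_on_def pairs_fst_ne_def pairs_snd_ne_def by auto
  show "path_val (shift i j) 0 (?h (a, p)) = snd (?Fs ! a) p" if "a < length ?Fs" for a p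
  proof -
    have "a = 0 \<or> a = 1 \<or> a = 2 \<or> a = 3" using that by auto
    then show ?thesis by (cases p) auto
  qed
qed

text \<open>Ending in row block 1 leaves only 2 as the middle row block of a two-step path, and the
  pairs (1,0), (1,2), (2,0) inside a three-step path. Now \<open>v\<close> is always the column
  block that must differ from \<open>l\<close>.\<close>

lemma leaves_1:
  assumes "l \<in> {1..n}"
  shows "all_non_equal_maximal N
        [(pairs_snd_ne n l, \<lambda>(u, v). i u - j u + j v),
         (pairs_snd_ne n l, \<lambda>(u, v). i u - i v + i l),
         (pairs_snd_ne n l, \<lambda>(u, v). (i u - j u) - (i v - j v) + i l),
         (pairs_snd_ne n l, \<lambda>(u, v). i u - j v + j l)] \<longleftrightarrow>
    leaves_separated N n (shift i j) l 1"
    (is "all_non_equal_maximal N ?Fs \<longleftrightarrow> _")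
  unfolding leaves_separated_def
proof (rule all_non_equal_maximal_iff_inj_on)
  let ?h = "(\<lambda>(a, (u, v)). [[(v, 2), (u, 1)], [(l, 1), (v, 0), (u, 1)],
          [(l, 1), (v, 2), (u, 1)], [(l, 2), (v, 0), (u, 1)]] ! a)
      :: nat \<times> nat \<times> nat \<Rightarrow> (nat \<times> nat) list"
  show "?h ` (SIGMA a:{..<length ?Fs}. fst (?Fs ! a)) = leaves n l 1"
  proof (rule Set.set_eqI)
    fix ps
    show "ps \<in> ?h ` (SIGMA a:{..<length ?Fs}. fst (?Fs ! a)) \<longleftrightarrow> ps \<in> leaves n l 1"
      using assms unfolding Sigma_nth_4
      by (cases ps rule: path_cases)
        (auto simp: image_Un image_iff pairs_fst_ne_def pairs_snd_ne_def less_3_iff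
          dest: leaves_length)
  qed
  show "inj_on ?h (SIGMA a:{..<length ?Fs}. fst (?Fs ! a))"
    unfolding Sigma_nth_4 inj_on_def pairs_fst_ne_def pairs_snd_ne_def by auto
  show "path_val (shift i j) 0 (?h (a, p)) = snd (?Fs ! a) p" if "a < length ?Fs" for a p
  proof -
    have "a = 0 \<or> a = 1 \<or> a = 2 \<or> a = 3" using that by auto
    then show ?thesis by (cases p) auto
  qed
qed

text \<open>As for \<open>leaves_1\<close> with row blocks 1 and 2 interchanged, which also permutes
  the shapes.\<close>

lemma leaves_2:
  assumes "l \<in> {1..n}"
  shows "all_non_equal_maximal N
        [(pairs_snd_ne n l, \<lambda>(u, v). j u - i u + i v),
         (pairs_snd_ne n l, \<lambda>(u, v). j u - i v + i l),
         (pairs_snd_ne n l, \<lambda>(u, v). j u - j v + j l),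
         (pairs_snd_ne n l, \<lambda>(u, v). j u - i u + i v - j v + j l)] \<longleftrightarrow>
    leaves_separated N n (shift i j) l 2"
    (is "all_non_equal_maximal N ?Fs \<longleftrightarrow> _")
  unfolding leaves_separated_def
proof (rule all_non_equal_maximal_iff_inj_on)
  let ?h = "(\<lambda>(a, (u, v)). [[(v, 1), (u, 2)], [(l, 1), (v, 0), (u, 2)],
          [(l, 2), (v, 0), (u, 2)], [(l, 2), (v, 1), (u, 2)]] ! a)
      :: nat \<times> nat \<times> nat \<Rightarrow> (nat \<times> nat) list"
  show "?h ` (SIGMA a:{..<length ?Fs}. fst (?Fs ! a)) = leaves n l 2"
  proof (rule Set.set_eqI)
    fix ps
    show "ps \<in> ?h ` (SIGMA a:{..<length ?Fs}. fst (?Fs ! a)) \<longleftrightarrow> ps \<in> leaves n l 2"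
      using assms unfolding Sigma_nth_4
      by (cases ps rule: path_cases)
        (auto simp: image_Un image_iff pairs_fst_ne_def pairs_snd_ne_def less_3_iff
          dest: leaves_length)
  qed
  show "inj_on ?h (SIGMA a:{..<length ?Fs}. fst (?Fs ! a))"
    unfolding Sigma_nth_4 inj_on_def pairs_fst_ne_def pairs_snd_ne_def by auto
  show "path_val (shift i j) 0 (?h (a, p)) = snd (?Fs ! a) p" if "a < length ?Fs" for a p
  proof -
    have "a = 0 \<or> a = 1 \<or> a = 2 \<or> a = 3" using that by auto
    then show ?thesis by (cases p) auto
  qed
qed

section \<open>The Tanner graph of \<open>H3\<close> and lifts of base paths\<close>

lemma H3_entry_iff:
  assumes "0 < N" "r < 3 * N" "c < n * N"
  shows "H3 N n i j $$ (r, c) = 1 \<longleftrightarrow>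
    [int r = int c + shift i j (r div N) (c div N + 1)] (mod int N)"
proof -
  have r: "r div N < 3" using assms by (simp add: less_mult_imp_div_less)
  \<comment> \<open>Indices inside a block are residues below \<open>N\<close>, so equality with a
    reduced index amounts to a congruence of unreduced ones.\<close>
  have entry: "circ N s $$ (r mod N, c mod N) = 1 \<longleftrightarrow> [int r = int c + s] (mod int N)" for s
  proof -
    have "nat ((int (c mod N) + s) mod int N) < N" using assms(1) by (simp add: nat_less_iff)
    then have "circ N s $$ (r mod N, c mod N) = 1 \<longleftrightarrow>
        int (r mod N) = (int (c mod N) + s) mod int N"
      using assms(1) by (auto simp: circ_def)
    also have "\<dots> \<longleftrightarrow> [int r = int c + s] (mod int N)"
      by (simp add: cong_def zmod_int mod_simps)
    finally show ?thesis .
  qed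
  have "1\<^sub>m N $$ (r mod N, c mod N) = (1::nat) \<longleftrightarrow> [int r = int c] (mod int N)"
    using assms(1) by (simp add: cong_def flip: zmod_int)
  moreover have "H3 N n i j $$ (r, c) =
      [1\<^sub>m N, circ N (i (c div N + 1)), circ N (j (c div N + 1))] ! (r div N) $$ (r mod N, c mod N)"
    using assms by (simp add: H3_def block_mat_def)
  moreover obtain b where b: "r div N = b" by blast
  ultimately show ?thesis
    using r entry unfolding b less_3_iff by (elim disjE) (simp_all del: One_nat_def)
qed

lemma dim_H3 [simp]: "dim_row (H3 N n i j) = 3 * N" "dim_col (H3 N n i j) = n * N"
  by (simp_all add: H3_def block_mat_def)

lemma tanner_H3_edge_iff:
  assumes "0 < N"
  shows "e \<in> snd (tanner_graph (H3 N n i j)) \<longleftrightarrow>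
    (\<exists>r c. e = {Check r, Var c} \<and> r < 3 * N \<and> c < n * N \<and>
      [int r = int c + shift i j (r div N) (c div N + 1)] (mod int N))"
  by (simp add: tanner_graph_def H3_entry_iff[OF assms] cong: conj_cong del: One_nat_def)

lemma simple_edges_tanner_graph: "simple_edges (tanner_graph M)"
  unfolding simple_edges_def tanner_graph_def by (auto simp: doubleton_eq_iff)

text \<open>Both \<open>chk\<close> and \<open>var\<close> take an unreduced integer position, so
  that displacements can simply be added. In \<open>var\<close> the column block is lowered by 1
  because \<open>H3\<close> counts its blocks from 0.\<close>

definition chk :: "nat \<Rightarrow> nat \<Rightarrow> int \<Rightarrow> tanner_vertex" where
  "chk N b x = Check (b * N + nat (x mod int N))"

definition var :: "nat \<Rightarrow> nat \<Rightarrow> int \<Rightarrow> tanner_vertex" where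
  "var N l y = Var ((l - 1) * N + nat (y mod int N))"

lemma block_index:
  assumes "0 < N"
  shows "(b * N + nat (x mod int N)) div N = b" "int (b * N + nat (x mod int N)) mod int N = x mod int N"
    "b < k \<Longrightarrow> b * N + nat (x mod int N) < k * N"
proof -
  have lt: "nat (x mod int N) < N" using assms by (simp add: nat_less_iff)
  then show "(b * N + nat (x mod int N)) div N = b" by simp
  show "int (b * N + nat (x mod int N)) mod int N = x mod int N" using assms by simp
  assume "b < k"
  then have "b * N + N \<le> k * N" by (metis Suc_leI add.commute mult_Suc mult_le_mono1)
  then show "b * N + nat (x mod int N) < k * N" using lt by linarith
qed

lemma chk_eqD: "0 < N \<Longrightarrow> chk N b x = chk N b' x' \<Longrightarrow> b = b'"
  unfolding chk_def using block_index(1) by (metis tanner_vertex.inject(1))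

lemma var_eqD:
  assumes "0 < N" "var N l y = var N l' y'" "Suc 0 \<le> l" "Suc 0 \<le> l'"
  shows "l = l'"
proof -
  have "l - 1 = l' - 1"
    using assms(1,2) unfolding var_def by (metis block_index(1) tanner_vertex.inject(2))
  \<comment> \<open>Truncated subtraction merges 0 and 1, hence the lower bounds on \<open>l\<close>
    and \<open>l'\<close>.\<close>
  then show ?thesis using assms by simp
qed

lemma chk_cong: "[x = x'] (mod int N) \<Longrightarrow> chk N b x = chk N b x'"
  by (simp add: chk_def cong_def)

lemma chk_var_edge:
  assumes "0 < N" "b < 3" "l \<in> {1..n}" "x = y + shift i j b l"
  shows "{chk N b x, var N l y} \<in> snd (tanner_graph (H3 N n i j))"
proof -
  define r c where rc: "r = b * N + nat (x mod int N)" "c = (l - 1) * N + nat (y mod int N)"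
  have div: "r div N = b" "c div N + 1 = l"
    using block_index(1)[OF assms(1)] assms(3) by (simp_all add: rc)
  have "int r mod int N = x mod int N" "int c mod int N = y mod int N"
    unfolding rc using block_index(2)[OF assms(1)] by blast+
  then have "[int r = int c + shift i j b l] (mod int N)"
    unfolding assms(4) cong_def by (metis mod_add_left_eq)
  moreover have "r < 3 * N" "c < n * N"
    unfolding rc using block_index(3)[OF assms(1)] assms by auto
  ultimately show ?thesis
    unfolding tanner_H3_edge_iff[OF assms(1)] chk_def var_def rc[symmetric] using div by auto
qed

text \<open>A voltage lift: position \<open>x\<close> of a check in row block \<open>b\<close>
  forces position \<open>x - e b l\<close> of its neighbour in column block \<open>l\<close>, by the
  edge condition of \<open>chk_var_edge\<close>.\<close>

fun lift_path :: "nat \<Rightarrow> (nat \<Rightarrow> nat \<Rightarrow> int) \<Rightarrow> nat \<Rightarrow> int \<Rightarrow> (nat \<times> nat) list \<Rightarrow> tanner_vertex list"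
  where
  "lift_path N e b x [] = [chk N b x]"
| "lift_path N e b x ((l, c) # ps) =
     chk N b x # var N l (x - e b l) # lift_path N e c (x - e b l + e c l) ps"

text \<open>Every vertex of a lift reveals its block by \<open>chk_eqD\<close> or
  \<open>var_eqD\<close>, and the path consists of these blocks.\<close>

lemma lift_path_inject:
  assumes "0 < N"
  shows "lift_path N e b x ps = lift_path N e b' x' qs \<Longrightarrow> \<forall>(l, c) \<in> set (ps @ qs). 1 \<le> l \<Longrightarrow>
    ps = qs"
proof (induction ps arbitrary: b x b' x' qs)
  case Nil
  then show ?case by (cases qs) auto
next
  case (Cons p ps)
  obtain l c where p: "p = (l, c)" by force
  from Cons.prems obtain l' c' qs' where qs: "qs = (l', c') # qs'"
    by (cases qs) (auto simp: p)
  have rest: "lift_path N e c (x - e b l + e c l) ps = lift_path N e c' (x' - e b' l' + e c' l') qs'"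
    using Cons.prems by (simp add: p qs)
  then have "hd (lift_path N e c (x - e b l + e c l) ps) =
      hd (lift_path N e c' (x' - e b' l' + e c' l') qs')" by simp
  then have "c = c'"
    by (cases ps; cases qs') (auto dest: chk_eqD[OF assms])
  moreover have "l = l'"
    using Cons.prems by (auto simp: p qs intro: var_eqD[OF assms])
  moreover have "ps = qs'"
    using Cons.IH[OF rest] Cons.prems by (auto simp: qs)
  ultimately show ?case by (simp add: p qs)
qed

lemma hd_lift_path: "hd (lift_path N e b x ps) = chk N b x"
  by (cases ps) auto

lemma lift_path_Nil [simp]: "lift_path N e b x ps \<noteq> []"
  by (cases ps) auto

lemma last_lift_path:
  "last (lift_path N e b x ps) = chk N (if ps = [] then b else snd (last ps)) (x + path_val e b ps)"
  by (induction ps arbitrary: b x) (auto simp: algebra_simps)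

lemma length_lift_path: "length (lift_path N e b x ps) = 2 * length ps + 1"
  by (induction ps arbitrary: b x) auto

lemma leaves_columns: "ps \<in> leaves n l z \<Longrightarrow> \<forall>(a, c) \<in> set ps. 1 \<le> a"
  unfolding leaves_def by auto

lemma last_leaves: "ps \<in> leaves n l z \<Longrightarrow> ps \<noteq> [] \<and> snd (last ps) = z"
  unfolding leaves_def by auto

text \<open>Along a leaf, consecutive row blocks differ and consecutive column blocks differ, and
  vertices in different blocks are different. This excludes backtracking.\<close>

lemma nb_walk_lift_leaves:
  assumes "0 < N" "ps \<in> leaves n l z" "z < 3"
  shows "nb_walk (tanner_graph (H3 N n i j)) (lift_path N (shift i j) 0 0 ps)"
proof -
  have edge: "{chk N b x, var N a y} \<in> snd (tanner_graph (H3 N n i j))"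
    "{var N a y, chk N b x} \<in> snd (tanner_graph (H3 N n i j))"
    if "b < 3" "a \<in> {1..n}" "x = y + shift i j b a" for a b x y
    using chk_var_edge[OF assms(1) that] by (simp_all add: insert_commute)
  show ?thesis
    using assms(2,3) unfolding leaves_def
    by (auto intro!: edge dest: chk_eqD[OF assms(1)] var_eqD[OF assms(1)])
qed

text \<open>Equal residues give lifts with the same last check, so \<open>nb_walk_unique\<close>
  applies. With girth above 10 it allows 12 vertices in total, exactly the 7 + 5 of a three-step and
  a two-step path; two three-step paths fit after deletion of the common first check.\<close>

lemma girth_imp_leaves_separated:
  assumes N: "0 < N" and girth: "girth (tanner_graph (H3 N n i j)) > enat 10" and z: "z < 3"
  shows "leaves_separated N n (shift i j) l z"
  unfolding leaves_separated_def
proof (rule inj_onI)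
  fix ps qs
  assume ps: "ps \<in> leaves n l z" and qs: "qs \<in> leaves n l z"
    and eq: "path_val (shift i j) 0 ps mod int N = path_val (shift i j) 0 qs mod int N"
  let ?P = "lift_path N (shift i j) 0 0 ps" and ?Q = "lift_path N (shift i j) 0 0 qs"
  note unique = nb_walk_unique[OF simple_edges_tanner_graph girth]
  have nb: "nb_walk (tanner_graph (H3 N n i j)) ?P" "nb_walk (tanner_graph (H3 N n i j)) ?Q"
    using nb_walk_lift_leaves[OF N _ z] ps qs by blast+
  have last: "last ?P = last ?Q"
    using last_leaves[OF ps] last_leaves[OF qs] eq
    by (auto simp: last_lift_path cong_def intro: chk_cong)
  have "?P = ?Q"
  proof (cases "length ps = 3 \<and> length qs = 3")
    case False
    then show ?thesis
      using leaves_length[OF ps] leaves_length[OF qs] nb last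
      by (intro unique) (auto simp: hd_lift_path length_lift_path)
  next
    case True
    \<comment> \<open>Both walks share their first edge, which would make the concatenation too long.\<close>
    then obtain x ps' y qs' where ps': "ps = (l, x) # ps'" and qs': "qs = (l, y) # qs'"
      using ps qs unfolding leaves_def by auto
    have "tl ?P = tl ?Q"
      using True nb last unfolding ps' qs'
      by (intro unique) (cases ps'; cases qs'; auto simp: length_lift_path)+
    then show ?thesis by (simp add: ps' qs')
  qed
  then show "ps = qs"
    using lift_path_inject[OF N, of "shift i j" 0 0 ps 0 0 qs] leaves_columns[OF ps] leaves_columns[OF qs]
    by auto
qed

text \<open>The closed walk visits the blocks \<open>b 0, l 0, b 1, l 1, \<dots>\<close> in this order, and \<open>2 * m\<close> is
  its length in the Tanner graph.\<close>

definition closed_word ::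
  "nat \<Rightarrow> nat \<Rightarrow> (nat \<Rightarrow> nat \<Rightarrow> int) \<Rightarrow> nat \<Rightarrow> (nat \<Rightarrow> nat) \<Rightarrow> (nat \<Rightarrow> nat) \<Rightarrow> bool" where
  "closed_word N n e m b l \<longleftrightarrow>
     (\<forall>t. b t < 3 \<and> l t \<in> {1..n} \<and> b (Suc t) \<noteq> b t \<and> l (Suc t) \<noteq> l t \<and>
        b (t + m) = b t \<and> l (t + m) = l t) \<and>
     int N dvd (\<Sum>t<m. e (b (Suc t)) (l t) - e (b t) (l t))"

section \<open>Rotation and repetition of closed words\<close>

lemma sum_periodic_shift:
  fixes g :: "nat \<Rightarrow> 'a::ab_group_add"
  assumes "\<And>t. g (t + m) = g t"
  shows "(\<Sum>t<m. g (t + s)) = (\<Sum>t<m. g t)"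
proof (induction s)
  case (Suc s)
  have "g s + (\<Sum>t<m. g (Suc t + s)) = (\<Sum>t<m. g (t + s)) + g (m + s)"
    using sum.lessThan_Suc_shift[of "\<lambda>t. g (t + s)" m] by simp
  then show ?case using Suc assms[of s] by (simp add: add.commute)
qed simp

lemma closed_word_shift:
  assumes "closed_word N n e m b l"
  shows "closed_word N n e m (\<lambda>t. b (t + s)) (\<lambda>t. l (t + s))"
proof -
  have per: "b (t + m) = b t" "l (t + m) = l t" for t
    using assms unfolding closed_word_def by auto
  have "(\<Sum>t<m. e (b (Suc (t + s))) (l (t + s)) - e (b (t + s)) (l (t + s))) =
      (\<Sum>t<m. e (b (Suc t)) (l t) - e (b t) (l t))"
    using sum_periodic_shift[of "\<lambda>t. e (b (Suc t)) (l t) - e (b t) (l t)" m s] per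
    by (metis (no_types, lifting) add_Suc)
  moreover have "b (t + m + s) = b (t + s)" "l (t + m + s) = l (t + s)" for t
    using per[of "t + s"] by (simp_all add: ac_simps)
  ultimately show ?thesis
    using assms unfolding closed_word_def by simp
qed

text \<open>Serves for 4-cycles: their word has \<open>m = 2\<close>, and traversing it twice gives
  one with \<open>m = 4\<close>.\<close>

lemma closed_word_double:
  assumes "closed_word N n e m b l"
  shows "closed_word N n e (2 * m) b l"
proof -
  define g where "g t = e (b (Suc t)) (l t) - e (b t) (l t)" for t
  have per: "b (t + m) = b t" "l (t + m) = l t" for t
    using assms unfolding closed_word_def by auto
  have gper: "g (t + m) = g t" for t
    using per[of "Suc t"] per[of t] by (simp add: g_def)
  have "(\<Sum>t<m + m. g t) = (\<Sum>t<m. g t) + (\<Sum>t<m. g (t + m))"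
  proof -
    have "(\<Sum>t<m + k. g t) = (\<Sum>t<m. g t) + (\<Sum>t<k. g (t + m))" for k
      by (induction k) (simp_all add: add.commute)
    then show ?thesis .
  qed
  also have "(\<Sum>t<m. g (t + m)) = (\<Sum>t<m. g t)"
    by (simp only: gper)
  finally have "(\<Sum>t<2 * m. g t) = (\<Sum>t<m. g t) + (\<Sum>t<m. g t)"
    by (simp only: mult_2)
  moreover have "int N dvd (\<Sum>t<m. g t)"
    using assms unfolding closed_word_def g_def by (rule conjunct2)
  ultimately have "int N dvd (\<Sum>t<2 * m. g t)"
    by (simp only: dvd_add)
  moreover have "b (t + 2 * m) = b t" "l (t + 2 * m) = l t" for t
    using per[of "t + m"] per[of t] by (simp_all add: mult_2 add.assoc add.left_commute add.commute)
  ultimately show ?thesis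
    using assms unfolding closed_word_def g_def by blast
qed

section \<open>Excluding short closed words and short cycles\<close>

lemma leaves_separatedD:
  assumes "leaves_separated N n e l z" "ps \<in> leaves n l z" "qs \<in> leaves n l z"
    and "int N dvd path_val e 0 ps - path_val e 0 qs"
  shows "ps = qs"
  using inj_onD[OF assms(1)[unfolded leaves_separated_def] _ assms(2,3)] assms(4)
  by (simp add: mod_eq_dvd_iff)

lemma closed_word_start:
  assumes "closed_word N n e m b l"
  obtains b' l' where "closed_word N n e m b' l'" "b' 0 = b s"
proof
  show "closed_word N n e m (\<lambda>t. b (t + s)) (\<lambda>t. l (t + s))"
    using assms by (rule closed_word_shift)
qed simp

text \<open>From row block 0, the first two steps read forwards and the last three read backwards
  are paths with the same end \<open>b' 2\<close>, whose values differ by the sum over the word.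
  Since \<open>l' 4\<close> and \<open>l' 0\<close> differ, both are leaves for \<open>l' 4\<close>.
  Having different lengths, they cannot be equal.\<close>

lemma no_closed_word_5:
  assumes sep: "\<And>l z. l \<in> {1..n} \<Longrightarrow> z < 3 \<Longrightarrow> leaves_separated N n e l z"
  shows "\<not> closed_word N n e 5 b l"
proof
  assume w: "closed_word N n e 5 b l"
  have "\<exists>s. b s = 0"
  proof (rule ccontr)
    assume nz: "\<nexists>s. b s = 0"
    have "b s \<noteq> 0" "b s < 3" "b (Suc s) \<noteq> b s" "b (s + 5) = b s" for s
      using w nz unfolding closed_word_def by auto
    \<comment> \<open>Without the value 0, \<open>b\<close> would alternate between 1 and 2, which
      the odd period 5 forbids.\<close>
    note this(1,2,3)[of 0] this(1,2,3)[of 1] this(1,2,3)[of 2] this(1,2,3)[of 3] this(1,2,3)[of 4]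
      this(4)[of 0]
    then show False by (simp add: eval_nat_numeral)
  qed
  then obtain s where "b s = 0" by blast
  then obtain b' l' where w: "closed_word N n e 5 b' l'" and b0: "b' 0 = 0"
    using closed_word_start[OF w, of s] by metis
  have step: "b' t < 3" "l' t \<in> {1..n}" "b' (Suc t) \<noteq> b' t" "l' (Suc t) \<noteq> l' t"
    and per: "b' (t + 5) = b' t" "l' (t + 5) = l' t" for t
    using w unfolding closed_word_def by auto
  have b5: "b' 5 = 0" and l5: "l' 5 = l' 0" using per[of 0] b0 by auto
  have "[(l' 0, b' 1), (l' 1, b' 2)] = [(l' 4, b' 4), (l' 3, b' 3), (l' 2, b' 2)]"
  proof (rule leaves_separatedD)
    show "leaves_separated N n e (l' 4) (b' 2)" using sep step by blast
    show "[(l' 0, b' 1), (l' 1, b' 2)] \<in> leaves n (l' 4) (b' 2)"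
      using step(1,2)[of 0] step(1,2)[of 1] step(3)[of 0] step(3)[of 1] step(4)[of 0] step(4)[of 4]
        b0 l5 by (simp add: eval_nat_numeral)
    show "[(l' 4, b' 4), (l' 3, b' 3), (l' 2, b' 2)] \<in> leaves n (l' 4) (b' 2)"
      using step(1,2)[of 4] step(1,2)[of 3] step(1,2)[of 2] step(3)[of 4] step(3)[of 3] step(3)[of 2]
        step(4)[of 2] step(4)[of 3] b5 by (simp add: eval_nat_numeral)
    have "path_val e 0 [(l' 0, b' 1), (l' 1, b' 2)] -
        path_val e 0 [(l' 4, b' 4), (l' 3, b' 3), (l' 2, b' 2)] =
        (\<Sum>t<5. e (b' (Suc t)) (l' t) - e (b' t) (l' t))"
      using b0 b5 by (simp add: eval_nat_numeral)
    then show "int N dvd path_val e 0 [(l' 0, b' 1), (l' 1, b' 2)] -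
        path_val e 0 [(l' 4, b' 4), (l' 3, b' 3), (l' 2, b' 2)]"
      using w unfolding closed_word_def by simp
  qed
  then show False by simp
qed

text \<open>Both ways around the word from row block 0 to \<open>b' 2\<close> are extended by the
  same step through \<open>l' 0\<close> back to row block 0. This is possible because
  \<open>l' 1\<close> and \<open>l' 2\<close> both differ from \<open>l' 0\<close>.\<close>

lemma no_closed_word_3:
  assumes sep: "\<And>l z. l \<in> {1..n} \<Longrightarrow> z < 3 \<Longrightarrow> leaves_separated N n e l z"
  shows "\<not> closed_word N n e 3 b l"
proof
  assume w: "closed_word N n e 3 b l"
  have "\<exists>s. b s = 0"
  proof (rule ccontr)
    assume nz: "\<nexists>s. b s = 0"
    have "b s \<noteq> 0" "b s < 3" "b (Suc s) \<noteq> b s" "b (s + 3) = b s" for s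
      using w nz unfolding closed_word_def by auto
    note this(1,2,3)[of 0] this(1,2,3)[of 1] this(1,2,3)[of 2] this(4)[of 0]
    then show False by (simp add: eval_nat_numeral)
  qed
  then obtain s where "b s = 0" by blast
  then obtain b' l' where w: "closed_word N n e 3 b' l'" and b0: "b' 0 = 0"
    using closed_word_start[OF w, of s] by metis
  have step: "b' t < 3" "l' t \<in> {1..n}" "b' (Suc t) \<noteq> b' t" "l' (Suc t) \<noteq> l' t"
    and per: "b' (t + 3) = b' t" "l' (t + 3) = l' t" for t
    using w unfolding closed_word_def by auto
  have b3: "b' 3 = 0" and l3: "l' 3 = l' 0" using per[of 0] b0 by auto
  have "[(l' 0, b' 1), (l' 1, b' 2), (l' 0, 0)] = [(l' 2, b' 2), (l' 0, 0)]"
  proof (rule leaves_separatedD)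
    show "leaves_separated N n e (l' 0) 0" using sep step by simp
    show "[(l' 0, b' 1), (l' 1, b' 2), (l' 0, 0)] \<in> leaves n (l' 0) 0"
      "[(l' 2, b' 2), (l' 0, 0)] \<in> leaves n (l' 0) 0"
      using step[of 0] step[of 1] step[of 2] b0 b3 l3 by (simp_all add: eval_nat_numeral)
    have "path_val e 0 [(l' 0, b' 1), (l' 1, b' 2), (l' 0, 0)] -
        path_val e 0 [(l' 2, b' 2), (l' 0, 0)] =
        (\<Sum>t<3. e (b' (Suc t)) (l' t) - e (b' t) (l' t))"
      using b0 b3 by (simp add: eval_nat_numeral)
    then show "int N dvd path_val e 0 [(l' 0, b' 1), (l' 1, b' 2), (l' 0, 0)] -
        path_val e 0 [(l' 2, b' 2), (l' 0, 0)]"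
      using w unfolding closed_word_def by simp
  qed
  then show False by simp
qed

text \<open>Only the differences of the columns \<open>p\<close> and \<open>q\<close> matter. They
  vanish in row block 0, so the sum is an integer combination of \<open>d1\<close> and
  \<open>d2\<close>; up to sign, six combinations occur. For each of them, two leaves that alternate
  between \<open>p\<close> and \<open>q\<close> differ by exactly this value.\<close>

lemma two_column_closed_word:
  fixes e :: "nat \<Rightarrow> nat \<Rightarrow> int"
  assumes sep: "\<And>l z. l \<in> {1..n} \<Longrightarrow> z < 3 \<Longrightarrow> leaves_separated N n e l z"
    and e0: "\<And>l. e 0 l = 0"
    and pq: "p \<in> {1..n}" "q \<in> {1..n}" "p \<noteq> q"
    and b: "b0 < 3" "b1 < 3" "b2 < 3" "b3 < 3" "b0 \<noteq> b1" "b1 \<noteq> b2" "b2 \<noteq> b3" "b3 \<noteq> b0"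
  shows "\<not> int N dvd
    (e b1 p - e b1 q) - (e b0 p - e b0 q) + (e b3 p - e b3 q) - (e b2 p - e b2 q)"
proof -
  have noteq: "\<not> int N dvd path_val e 0 ps - path_val e 0 qs"
    if "ps \<in> leaves n p z" "qs \<in> leaves n p z" "z < 3" "ps \<noteq> qs" for ps qs z
    using leaves_separatedD[OF sep[OF pq(1) that(3)] that(1,2)] that(4) by blast
  define d1 d2 where d: "d1 = e 1 p - e 1 q" "d2 = e 2 p - e 2 q"
  have "\<not> int N dvd 2 * d1"
    using noteq[of "[(p, 1), (q, 0), (p, 2)]" 2 "[(q, 1), (p, 2)]"] pq
    by (simp add: e0 d algebra_simps)
  moreover have "\<not> int N dvd 2 * d2"
    using noteq[of "[(p, 2), (q, 0), (p, 1)]" 1 "[(q, 2), (p, 1)]"] pq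
    by (simp add: e0 d algebra_simps)
  moreover have "\<not> int N dvd 2 * d1 - 2 * d2"
    using noteq[of "[(p, 1), (q, 2), (p, 0)]" 0 "[(p, 2), (q, 1), (p, 0)]"] pq
    by (simp add: e0 d algebra_simps)
  moreover have "\<not> int N dvd d1 + d2"
    using noteq[of "[(p, 1), (q, 0), (p, 1)]" 1 "[(q, 2), (p, 1)]"] pq
    by (simp add: e0 d algebra_simps)
  moreover have "\<not> int N dvd 2 * d1 - d2"
    using noteq[of "[(p, 1), (q, 2), (p, 0)]" 0 "[(q, 1), (p, 0)]"] pq
    by (simp add: e0 d algebra_simps)
  moreover have "\<not> int N dvd 2 * d2 - d1"
    using noteq[of "[(p, 2), (q, 1), (p, 0)]" 0 "[(q, 2), (p, 0)]"] pq
    by (simp add: e0 d algebra_simps)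
  moreover
  define x where "x = (e b1 p - e b1 q) - (e b0 p - e b0 q) + (e b3 p - e b3 q) - (e b2 p - e b2 q)"
  \<comment> \<open>The sets \<open>{b0, b2}\<close> and \<open>{b1, b3}\<close> are disjoint, and
    interchanging them changes the sign of \<open>x\<close>.\<close>
  have "x \<in> {2 * d1, 2 * d2, 2 * d1 - 2 * d2, d1 + d2, 2 * d1 - d2, 2 * d2 - d1} \<or>
      - x \<in> {2 * d1, 2 * d2, 2 * d1 - 2 * d2, d1 + d2, 2 * d1 - d2, 2 * d2 - d1}"
    using b unfolding less_3_iff x_def by (elim disjE) (simp_all add: d e0)
  ultimately show ?thesis
    unfolding x_def[symmetric] by (metis dvd_minus_iff empty_iff insert_iff)
qed

lemma no_closed_word_4:
  assumes sep: "\<And>l z. l \<in> {1..n} \<Longrightarrow> z < 3 \<Longrightarrow> leaves_separated N n e l z"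
    and e0: "\<And>l. e 0 l = 0"
  shows "\<not> closed_word N n e 4 b l"
proof
  assume w: "closed_word N n e 4 b l"
  \<comment> \<open>The extension below begins with a step from row block 0 to \<open>b' 0\<close>,
    so the word is rotated to start at a nonzero row block.\<close>
  have "b 0 \<noteq> 0 \<or> b (Suc 0) \<noteq> 0" using w unfolding closed_word_def by metis
  then obtain s where "b s \<noteq> 0" by blast
  then obtain b' l' where w: "closed_word N n e 4 b' l'" and b0: "b' 0 \<noteq> 0"
    using closed_word_start[OF w, of s] by metis
  have step: "b' t < 3" "l' t \<in> {1..n}" "b' (Suc t) \<noteq> b' t" "l' (Suc t) \<noteq> l' t"
    and per: "b' (t + 4) = b' t" "l' (t + 4) = l' t" for t
    using w unfolding closed_word_def by auto
  have b4: "b' 4 = b' 0" and l4: "l' 4 = l' 0" using per[of 0] by auto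
  note steps = step[of 0] step[of 1] step[of 2] step[of 3] b4 l4
  have dvd: "int N dvd (\<Sum>t<4. e (b' (Suc t)) (l' t) - e (b' t) (l' t))"
    using w unfolding closed_word_def by simp
  show False
  \<comment> \<open>If this holds, only \<open>l' 0\<close> and \<open>l' 1\<close> are visited, and
    a third column block need not exist.\<close>
  proof (cases "l' 2 = l' 0 \<and> l' 3 = l' 1")
    case True
    have ne: "l' 0 \<noteq> l' 1" "b' 0 \<noteq> b' 1" "b' 1 \<noteq> b' 2" "b' 2 \<noteq> b' 3" "b' 3 \<noteq> b' 0"
      using step(4)[of 0] step(3)[of 0] step(3)[of 1] step(3)[of 2] step(3)[of 3] b4
      by (simp_all add: eval_nat_numeral)
    have "(\<Sum>t<4. e (b' (Suc t)) (l' t) - e (b' t) (l' t)) =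
        (e (b' 1) (l' 0) - e (b' 1) (l' 1)) - (e (b' 0) (l' 0) - e (b' 0) (l' 1)) +
        (e (b' 3) (l' 0) - e (b' 3) (l' 1)) - (e (b' 2) (l' 0) - e (b' 2) (l' 1))"
      using True b4 by (simp add: eval_nat_numeral)
    moreover have "\<not> int N dvd
        (e (b' 1) (l' 0) - e (b' 1) (l' 1)) - (e (b' 0) (l' 0) - e (b' 0) (l' 1)) +
        (e (b' 3) (l' 0) - e (b' 3) (l' 1)) - (e (b' 2) (l' 0) - e (b' 2) (l' 1))"
      by (rule two_column_closed_word[OF sep e0 step(2) step(2) ne(1) step(1) step(1) step(1) step(1)
        ne(2-5)])
    ultimately show False using dvd by (simp only:)
  next
    case False
    have "l' 0 \<noteq> l' 1" "l' 1 \<noteq> l' 2" "l' 2 \<noteq> l' 3" "l' 3 \<noteq> l' 0"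
      using steps by (auto simp: eval_nat_numeral)
    \<comment> \<open>The column block \<open>l' 2\<close> serves if it differs from
      \<open>l' 0\<close>, and \<open>l' 1\<close> otherwise.\<close>
    then obtain k where k: "k \<in> {1..n}" "k \<noteq> l' 0" "k \<noteq> l' 3"
      using False step(2) by metis
    \<comment> \<open>Both halves of the word lead from \<open>b' 0\<close> to \<open>b' 2\<close>;
      the common first step through \<open>k\<close> turns them into three-step leaves. Their
      equality would force \<open>l' 0 = l' 3\<close>.\<close>
    have "[(k, b' 0), (l' 0, b' 1), (l' 1, b' 2)] = [(k, b' 0), (l' 3, b' 3), (l' 2, b' 2)]"
    proof (rule leaves_separatedD)
      show "leaves_separated N n e k (b' 2)" using sep step k by blast
      show "[(k, b' 0), (l' 0, b' 1), (l' 1, b' 2)] \<in> leaves n k (b' 2)"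
        "[(k, b' 0), (l' 3, b' 3), (l' 2, b' 2)] \<in> leaves n k (b' 2)"
        using steps k b0 by (simp_all add: eval_nat_numeral)
      have "path_val e 0 [(k, b' 0), (l' 0, b' 1), (l' 1, b' 2)] -
          path_val e 0 [(k, b' 0), (l' 3, b' 3), (l' 2, b' 2)] =
          (\<Sum>t<4. e (b' (Suc t)) (l' t) - e (b' t) (l' t))"
        using b4 by (simp add: eval_nat_numeral)
      then show "int N dvd path_val e 0 [(k, b' 0), (l' 0, b' 1), (l' 1, b' 2)] -
          path_val e 0 [(k, b' 0), (l' 3, b' 3), (l' 2, b' 2)]"
        using dvd by simp
    qed
    then show False using steps by (simp add: eval_nat_numeral)
  qed
qed

text \<open>A cycle visits checks and variables alternately; the word lists the blocks it visits,
  starting from a check. Unrolling the cycle to a periodic sequence makes the closing step an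
  ordinary one.\<close>

lemma cycle_imp_closed_word:
  assumes N: "0 < N" and p: "is_cycle (tanner_graph (H3 N n i j)) p"
  obtains m b l where "length p = 2 * m" "closed_word N n (shift i j) m b l"
proof -
  let ?E = "snd (tanner_graph (H3 N n i j))" and ?e = "shift i j"
  define k where "k = length p"
  have k: "3 \<le> k" and dist: "distinct p"
    and cyc: "\<And>t. t < k \<Longrightarrow> {p ! t, p ! (Suc t mod k)} \<in> ?E"
    using p unfolding is_cycle_def k_def by auto
  define f where "f t = p ! (t mod k)" for t
  have f_edge: "{f t, f (Suc t)} \<in> ?E" for t
    using cyc[of "t mod k"] k by (simp add: f_def mod_Suc_eq)
  have f_ne: "f (Suc (Suc t)) \<noteq> f t" for t
  proof
    assume "f (Suc (Suc t)) = f t"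
    moreover have "Suc (Suc t) mod k < length p" "t mod k < length p"
      using k by (simp_all add: k_def[symmetric])
    ultimately have "(t + 2) mod k = t mod k"
      unfolding f_def using nth_eq_iff_index_eq[OF dist] by simp
    then have "k dvd 2" using mod_eq_dvd_iff_nat[of t "t + 2" k] by simp
    then show False using k dvd_imp_le[of k 2] by simp
  qed
  have f_per: "f (t + k) = f t" for t by (simp add: f_def)
  define is_chk where "is_chk v \<longleftrightarrow> (\<exists>r. v = Check r)" for v
  have alt: "is_chk (f (Suc t)) \<longleftrightarrow> \<not> is_chk (f t)" for t
    using f_edge[of t] unfolding tanner_H3_edge_iff[OF N] is_chk_def
    by (auto simp: doubleton_eq_iff)
  have "is_chk (f 0) \<or> is_chk (f (Suc 0))" using alt[of 0] by blast
  then obtain s where s: "is_chk (f s)" by blast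
  define g where "g t = f (s + t)" for t
  have g_alt: "is_chk (g t) \<longleftrightarrow> even t" for t
    by (induction t) (use s alt in \<open>auto simp: g_def\<close>)
  have g_per: "g (t + k) = g t" for t using f_per[of "s + t"] by (simp add: g_def add.assoc)
  have "even k" using g_alt[of 0] g_alt[of k] g_per[of 0] by simp
  then obtain m where m: "k = 2 * m" by blast
  have "\<exists>r c. g (2 * t) = Check r \<and> g (Suc (2 * t)) = Var c" for t
    using f_edge[of "s + 2 * t"] g_alt[of "2 * t"]
    unfolding tanner_H3_edge_iff[OF N] is_chk_def by (auto simp: g_def doubleton_eq_iff)
  then obtain r c where rc: "\<And>t. g (2 * t) = Check (r t)" "\<And>t. g (Suc (2 * t)) = Var (c t)"
    by metis
  have edge1: "r t < 3 * N" "c t < n * N" "[int (r t) = int (c t) + ?e (r t div N) (c t div N + 1)] (mod int N)"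
    for t
    using f_edge[of "s + 2 * t"] rc[of t] unfolding tanner_H3_edge_iff[OF N]
    by (auto simp: g_def doubleton_eq_iff)
  have edge2: "[int (r (Suc t)) = int (c t) + ?e (r (Suc t) div N) (c t div N + 1)] (mod int N)" for t
    using f_edge[of "Suc (s + 2 * t)"] rc[of t] rc(1)[of "Suc t"] unfolding tanner_H3_edge_iff[OF N]
    by (auto simp: g_def doubleton_eq_iff)
  have r_ne: "r (Suc t) \<noteq> r t" and c_ne: "c (Suc t) \<noteq> c t" for t
    using f_ne[of "s + 2 * t"] f_ne[of "s + Suc (2 * t)"] rc[of t] rc[of "Suc t"]
    by (auto simp: g_def)
  have r_per: "r (t + m) = r t" and c_per: "c (t + m) = c t" for t
    using g_per[of "2 * t"] g_per[of "Suc (2 * t)"] rc[of t] rc[of "t + m"]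
    by (simp_all add: m algebra_simps)
  \<comment> \<open>A vertex is determined by its block and its residue. Two neighbours of the same
    vertex in the same block are congruent, hence equal, so distinct neighbours lie in different
    blocks.\<close>
  have eqI: "x = y" if "x div N = y div N" "[int x = int y] (mod int N)" for x y
    using that by (metis cong_def cong_int_iff div_mult_mod_eq)
  have "r (Suc t) div N \<noteq> r t div N" for t
    using eqI[of "r (Suc t)" "r t"] r_ne[of t] edge1(3)[of t] edge2[of t]
    by (metis cong_sym cong_trans)
  moreover have "c (Suc t) div N + 1 \<noteq> c t div N + 1" for t
  proof
    assume eq: "c (Suc t) div N + 1 = c t div N + 1"
    have "[int (c t) = int (c (Suc t))] (mod int N)"
      using edge1(3)[of "Suc t"] edge2[of t] unfolding eq
      by (metis cong_add_rcancel cong_sym cong_trans)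
    then show False using eqI[of "c t" "c (Suc t)"] eq c_ne[of t] by simp
  qed
  moreover have "r t div N < 3" "c t div N + 1 \<in> {1..n}" for t
    using edge1[of t] N by (auto simp: less_mult_imp_div_less Suc_le_eq)
  moreover have "int N dvd (\<Sum>t<m. ?e (r (Suc t) div N) (c t div N + 1) - ?e (r t div N) (c t div N + 1))"
  proof -
    \<comment> \<open>Both checks are adjacent to the variable \<open>c t\<close>, so modulo
      \<open>N\<close> the exponent difference equals the change of the check index, and these
      changes telescope to 0 around the cycle.\<close>
    have "int N dvd (?e (r (Suc t) div N) (c t div N + 1) - ?e (r t div N) (c t div N + 1)) -
        (int (r (Suc t)) - int (r t))" for t
    proof -
      have "int N dvd (int (r t) - (int (c t) + ?e (r t div N) (c t div N + 1))) -
          (int (r (Suc t)) - (int (c t) + ?e (r (Suc t) div N) (c t div N + 1)))"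
        using edge1(3)[of t] edge2[of t] unfolding cong_iff_dvd_diff by (rule dvd_diff)
      then show ?thesis by (simp add: algebra_simps)
    qed
    then have "int N dvd (\<Sum>t<m. (?e (r (Suc t) div N) (c t div N + 1) - ?e (r t div N) (c t div N + 1)) -
        (int (r (Suc t)) - int (r t)))" by (intro dvd_sum) auto
    moreover have "(\<Sum>t<m. int (r (Suc t)) - int (r t)) = 0"
      using sum_lessThan_telescope[of "\<lambda>t. int (r t)" m] r_per[of 0] by simp
    ultimately show ?thesis by (simp add: sum_subtractf)
  qed
  ultimately have "closed_word N n ?e m (\<lambda>t. r t div N) (\<lambda>t. c t div N + 1)"
    unfolding closed_word_def by (simp add: r_per c_per)
  moreover have "length p = 2 * m" using m by (simp add: k_def)
  ultimately show thesis by (intro that)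
qed

lemma leaves_separated_imp_girth:
  assumes N: "0 < N"
    and sep: "\<And>l z. l \<in> {1..n} \<Longrightarrow> z < 3 \<Longrightarrow> leaves_separated N n (shift i j) l z"
  shows "girth (tanner_graph (H3 N n i j)) > enat 10"
  unfolding girth_greater_iff
proof (intro allI impI, rule ccontr)
  fix p assume p: "is_cycle (tanner_graph (H3 N n i j)) p" "\<not> 10 < length p"
  obtain m b l where m: "length p = 2 * m" and w: "closed_word N n (shift i j) m b l"
    using cycle_imp_closed_word[OF N p(1)] by blast
  have "3 \<le> length p" using p(1) by (simp add: is_cycle_def)
  \<comment> \<open>The length is even and at least 3, hence at least 4.\<close>
  then consider "m = 2" | "m = 3" | "m = 4" | "m = 5" using m p(2) by linarith
  then show False
  proof cases
    case 1
    then show ?thesis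
      using closed_word_double[OF w] no_closed_word_4[OF sep] by simp
  qed (use w no_closed_word_3[OF sep] no_closed_word_4[OF sep] no_closed_word_5[OF sep] in auto)
qed

theorem theorem44:
  fixes n N :: nat and i j :: "nat \<Rightarrow> int"
  assumes "1 \<le> n" and "1 \<le> N"
    and "[i 1 = 0] (mod int N)" and "[j 1 = 0] (mod int N)"
  shows "girth (tanner_graph (H3 N n i j)) > 10 \<longleftrightarrow>
    (\<forall>l \<in> {1..n}.
      all_non_equal_maximal N
        [(pairs_fst_ne n l, \<lambda>(u, v). i u - i v),
         (pairs_fst_ne n l, \<lambda>(u, v). j u - j v),
         (pairs_snd_ne n l, \<lambda>(u, v). - j u + j v - i v + i l),
         (pairs_snd_ne n l, \<lambda>(u, v). - i u + i v - j v + j l)] \<and>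
      all_non_equal_maximal N
        [(pairs_snd_ne n l, \<lambda>(u, v). i u - j u + j v),
         (pairs_snd_ne n l, \<lambda>(u, v). i u - i v + i l),
         (pairs_snd_ne n l, \<lambda>(u, v). (i u - j u) - (i v - j v) + i l),
         (pairs_snd_ne n l, \<lambda>(u, v). i u - j v + j l)] \<and>
      all_non_equal_maximal N
        [(pairs_snd_ne n l, \<lambda>(u, v). j u - i u + i v),
         (pairs_snd_ne n l, \<lambda>(u, v). j u - i v + i l),
         (pairs_snd_ne n l, \<lambda>(u, v). j u - j v + j l),
         (pairs_snd_ne n l, \<lambda>(u, v). j u - i u + i v - j v + j l)])"
    (is "_ \<longleftrightarrow> (\<forall>l \<in> {1..n}. ?C l)")
proof -
  have N: "0 < N" using assms by simp
  \<comment> \<open>The three conditions are the separation statements for the end blocks 0, 1 and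
    2.\<close>
  have "?C l \<longleftrightarrow> (\<forall>z<3. leaves_separated N n (shift i j) l z)" if "l \<in> {1..n}" for l
    unfolding leaves_0[OF that] leaves_1[OF that] leaves_2[OF that] less_3_iff by auto
  then have "(\<forall>l \<in> {1..n}. ?C l) \<longleftrightarrow>
      (\<forall>l \<in> {1..n}. \<forall>z<3. leaves_separated N n (shift i j) l z)" by (rule ball_cong[OF refl])
  moreover have "girth (tanner_graph (H3 N n i j)) > enat 10 \<longleftrightarrow>
      (\<forall>l \<in> {1..n}. \<forall>z<3. leaves_separated N n (shift i j) l z)"
    using girth_imp_leaves_separated[OF N] leaves_separated_imp_girth[OF N] by blast
  moreover have "enat 10 = 10" by (simp add: numeral_eq_enat)
  ultimately show ?thesis by simp
qed

end
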